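(* Let $\vec{\mathcal X}$ be a couple of translation invariant pseudolattices and $\vec B=(B_0,B_1)$ a complex Banach couple. Let $\{f_n\}_{n\in\mathbb Z}\in\mathcal J(\vec{\mathcal X},\vec B)$ and $f(z)=\sum_{n\in\mathbb Z}z^nf_n$, $z\in\mathbb A$. Suppose $f(s)=0$ for some $s\in\mathbb A$, and define $g:\mathbb A\to B_0+B_1$ by $g(s)=f'(s)$ and $g(z)=f(z)/(z-s)$ for $z\ne s$. Then $g\in\mathcal F_{\vec{\mathcal X}}(\vec B)$, and the Laurent coefficients $\{g_n\}$ of $g$ on $\mathbb A$ (i.e. $g(z)=\sum_n z^ng_n$) satisfy $\{g_n\}\in\mathcal J(\vec{\mathcal X},\vec B)$ and $$\|\{g_n\}\|_{\mathcal J(\vec{\mathcal X},\vec B)}\le\delta(s)\|\{f_n\}\|_{\mathcal J(\vec{\mathcal X},\vec B)},\qquad \delta(s)=\max\{(|s|-1)^{-1},(e-|s|)^{-1}\}.$$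
   Context: A pseudolattice $\mathcal{X}$ assigns to every complex Banach space $B$ a Banach space $\mathcal{X}(B)$ of two-sided sequences in $B$ such that: $\mathcal X(A)$ is a closed subspace of $\mathcal X(B)$ when $A$ is a closed subspace of $B$; $\|\{Ta_n\}\|_{\mathcal{X}(B)}\le C\|T\|\|\{a_n\}\|_{\mathcal{X}(A)}$ for bounded linear $T:A\to B$ with a fixed $C$; and $\|b_m\|_B\le\|\{b_n\}\|_{\mathcal{X}(B)}$. A couple $(\mathcal X_0,\mathcal X_1)$ is translation invariant if the shifts $\{b_n\}\mapsto\{b_{n+k}\}$, $k\in\mathbb Z$, are isometries of each $\mathcal X_j(B)$ onto itself for every $B$. $\mathcal{J}(\vec{\mathcal{X}},\vec B)$ is the Banach space of sequences $\{b_n\}\subset B_0\cap B_1$ with norm $\max\{\|\{b_n\}\|_{\mathcal{X}_0(B_0)},\|\{e^nb_n\}\|_{\mathcal{X}_1(B_1)}\}<\infty$. $\mathbb{A}=\{z\in\mathbb C:1<|z|<e\}$. $\mathcal{F}_{\vec{\mathcal{X}}}(\vec B)$ is the Banach space of analytic functions $f:\mathbb{A}\to B_0+B_1$, $f(z)=\sum_n z^nb_n$ with $\{b_n\}\in\mathcal{J}(\vec{\mathcal{X}},\vec B)$, normed by $\|\{b_n\}\|_{\mathcal J}$. *)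

theory Defs
  imports "HOL-Analysis.Analysis" "HOL-Library.Function_Algebras"
begin

text \<open>Complex Banach spaces are modelled inside a fixed ambient complex vector
 space (type 'v with complex scalar multiplication sc): a Banach space is a pair
 (S, N) of a complex subspace S and a function N that is a complete norm on S.\<close>

definition csubspace :: "(complex \<Rightarrow> 'a::ab_group_add \<Rightarrow> 'a) \<Rightarrow> 'a set \<Rightarrow> bool" where
  "csubspace sc S \<longleftrightarrow> 0 \<in> S \<and> (\<forall>x\<in>S. \<forall>y\<in>S. x + y \<in> S) \<and> (\<forall>c. \<forall>x\<in>S. sc c x \<in> S)"

definition cbanach :: "(complex \<Rightarrow> 'a::ab_group_add \<Rightarrow> 'a) \<Rightarrow> 'a set \<Rightarrow> ('a \<Rightarrow> real) \<Rightarrow> bool" where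
  "cbanach sc S N \<longleftrightarrow> csubspace sc S
     \<and> (\<forall>x\<in>S. N x \<ge> 0 \<and> (N x = 0 \<longleftrightarrow> x = 0))
     \<and> (\<forall>c. \<forall>x\<in>S. N (sc c x) = cmod c * N x)
     \<and> (\<forall>x\<in>S. \<forall>y\<in>S. N (x + y) \<le> N x + N y)
     \<and> (\<forall>u. (\<forall>n. u n \<in> S) \<and> (\<forall>\<epsilon>>0. \<exists>M. \<forall>m\<ge>M. \<forall>n\<ge>M. N (u m - u n) < \<epsilon>)
            \<longrightarrow> (\<exists>x\<in>S. (\<lambda>n. N (u n - x)) \<longlonglongrightarrow> 0))"

definition seqscale :: "(complex \<Rightarrow> 'v \<Rightarrow> 'v) \<Rightarrow> complex \<Rightarrow> (int \<Rightarrow> 'v) \<Rightarrow> (int \<Rightarrow> 'v)" where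
  "seqscale sc c b = (\<lambda>n. sc c (b n))"

definition closed_subspace_of :: "(complex \<Rightarrow> 'v::ab_group_add \<Rightarrow> 'v) \<Rightarrow> 'v set \<Rightarrow> ('v \<Rightarrow> real) \<Rightarrow> 'v set \<Rightarrow> ('v \<Rightarrow> real) \<Rightarrow> bool" where
  "closed_subspace_of sc S' N' S N \<longleftrightarrow> S' \<subseteq> S \<and> csubspace sc S' \<and> (\<forall>x\<in>S'. N' x = N x)
     \<and> (\<forall>u x. (\<forall>n. u n \<in> S') \<and> x \<in> S \<and> (\<lambda>n. N (u n - x)) \<longlonglongrightarrow> 0 \<longrightarrow> x \<in> S')"

definition bounded_op :: "(complex \<Rightarrow> 'v::ab_group_add \<Rightarrow> 'v) \<Rightarrow> 'v set \<Rightarrow> ('v \<Rightarrow> real) \<Rightarrow> 'v set \<Rightarrow> ('v \<Rightarrow> real) \<Rightarrow> ('v \<Rightarrow> 'v) \<Rightarrow> real \<Rightarrow> bool" where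
  "bounded_op sc SA NA SB NB T M \<longleftrightarrow> T ` SA \<subseteq> SB
     \<and> (\<forall>x\<in>SA. \<forall>y\<in>SA. T (x + y) = T x + T y) \<and> (\<forall>c. \<forall>x\<in>SA. T (sc c x) = sc c (T x))
     \<and> M \<ge> 0 \<and> (\<forall>x\<in>SA. NB (T x) \<le> M * NA x)"

text \<open>A pseudolattice: X S N = (X(B), norm of X(B)) for the Banach space B = (S, N).\<close>
type_synonym 'v pseudolat = "'v set \<Rightarrow> ('v \<Rightarrow> real) \<Rightarrow> (int \<Rightarrow> 'v) set \<times> ((int \<Rightarrow> 'v) \<Rightarrow> real)"

definition pseudolattice :: "(complex \<Rightarrow> 'v::ab_group_add \<Rightarrow> 'v) \<Rightarrow> 'v pseudolat \<Rightarrow> bool" where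
  "pseudolattice sc X \<longleftrightarrow>
     (\<forall>S N. cbanach sc S N \<longrightarrow>
        fst (X S N) \<subseteq> {b. \<forall>n. b n \<in> S}
        \<and> cbanach (seqscale sc) (fst (X S N)) (snd (X S N))
        \<and> (\<forall>b\<in>fst (X S N). \<forall>m. N (b m) \<le> snd (X S N) b))
   \<and> (\<forall>S N S' N'. cbanach sc S N \<and> closed_subspace_of sc S' N' S N \<longrightarrow>
        fst (X S' N') = fst (X S N) \<inter> {b. \<forall>n. b n \<in> S'}
        \<and> (\<forall>b\<in>fst (X S' N'). snd (X S' N') b = snd (X S N) b))
   \<and> (\<exists>C. \<forall>SA NA SB NB T M. cbanach sc SA NA \<and> cbanach sc SB NB \<and> bounded_op sc SA NA SB NB T M \<longrightarrow>
        (\<forall>b\<in>fst (X SA NA). T \<circ> b \<in> fst (X SB NB) \<and> snd (X SB NB) (T \<circ> b) \<le> C * M * snd (X SA NA) b))"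

definition translation_invariant :: "(complex \<Rightarrow> 'v::ab_group_add \<Rightarrow> 'v) \<Rightarrow> 'v pseudolat \<Rightarrow> bool" where
  "translation_invariant sc X \<longleftrightarrow>
     (\<forall>S N. cbanach sc S N \<longrightarrow> (\<forall>k::int. \<forall>b\<in>fst (X S N).
        (\<lambda>n. b (n + k)) \<in> fst (X S N) \<and> snd (X S N) (\<lambda>n. b (n + k)) = snd (X S N) b))"

definition sumspace :: "'v::ab_group_add set \<Rightarrow> 'v set \<Rightarrow> 'v set" where
  "sumspace S0 S1 = {a + b | a b. a \<in> S0 \<and> b \<in> S1}"

definition sumnorm :: "'v::ab_group_add set \<Rightarrow> ('v \<Rightarrow> real) \<Rightarrow> 'v set \<Rightarrow> ('v \<Rightarrow> real) \<Rightarrow> 'v \<Rightarrow> real" where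
  "sumnorm S0 N0 S1 N1 x = Inf {N0 a + N1 b | a b. a \<in> S0 \<and> b \<in> S1 \<and> x = a + b}"

text \<open>Banach couple: both spaces Banach, and B0 + B1 (with the K-norm) Hausdorff,
  i.e. the K-norm vanishes only at 0 (equivalent to compatibility).\<close>
definition banach_couple :: "(complex \<Rightarrow> 'v::ab_group_add \<Rightarrow> 'v) \<Rightarrow> 'v set \<Rightarrow> ('v \<Rightarrow> real) \<Rightarrow> 'v set \<Rightarrow> ('v \<Rightarrow> real) \<Rightarrow> bool" where
  "banach_couple sc S0 N0 S1 N1 \<longleftrightarrow> cbanach sc S0 N0 \<and> cbanach sc S1 N1
     \<and> (\<forall>x\<in>sumspace S0 S1. sumnorm S0 N0 S1 N1 x = 0 \<longrightarrow> x = 0)"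

definition Jset :: "(complex \<Rightarrow> 'v::ab_group_add \<Rightarrow> 'v) \<Rightarrow> 'v pseudolat \<Rightarrow> 'v pseudolat
     \<Rightarrow> 'v set \<Rightarrow> ('v \<Rightarrow> real) \<Rightarrow> 'v set \<Rightarrow> ('v \<Rightarrow> real) \<Rightarrow> (int \<Rightarrow> 'v) set" where
  "Jset sc X0 X1 S0 N0 S1 N1 = {b. (\<forall>n. b n \<in> S0 \<inter> S1) \<and> b \<in> fst (X0 S0 N0)
      \<and> (\<lambda>n. sc (complex_of_real (exp (real_of_int n))) (b n)) \<in> fst (X1 S1 N1)}"

definition Jnorm :: "(complex \<Rightarrow> 'v::ab_group_add \<Rightarrow> 'v) \<Rightarrow> 'v pseudolat \<Rightarrow> 'v pseudolat
     \<Rightarrow> 'v set \<Rightarrow> ('v \<Rightarrow> real) \<Rightarrow> 'v set \<Rightarrow> ('v \<Rightarrow> real) \<Rightarrow> (int \<Rightarrow> 'v) \<Rightarrow> real" where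
  "Jnorm sc X0 X1 S0 N0 S1 N1 b = max (snd (X0 S0 N0) b)
      (snd (X1 S1 N1) (\<lambda>n. sc (complex_of_real (exp (real_of_int n))) (b n)))"

definition annulus :: "complex set" where
  "annulus = {z. 1 < cmod z \<and> cmod z < exp 1}"

definition laurent_sums :: "(complex \<Rightarrow> 'v::ab_group_add \<Rightarrow> 'v) \<Rightarrow> 'v set \<Rightarrow> ('v \<Rightarrow> real) \<Rightarrow> 'v set \<Rightarrow> ('v \<Rightarrow> real)
     \<Rightarrow> (int \<Rightarrow> 'v) \<Rightarrow> complex \<Rightarrow> 'v \<Rightarrow> bool" where
  "laurent_sums sc S0 N0 S1 N1 b z y \<longleftrightarrow> y \<in> sumspace S0 S1 \<and>
     (\<lambda>K::nat. sumnorm S0 N0 S1 N1 ((\<Sum>n\<in>{- int K..int K}. sc (z powi n) (b n)) - y)) \<longlonglongrightarrow> 0"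

definition laurent_val :: "(complex \<Rightarrow> 'v::ab_group_add \<Rightarrow> 'v) \<Rightarrow> 'v set \<Rightarrow> ('v \<Rightarrow> real) \<Rightarrow> 'v set \<Rightarrow> ('v \<Rightarrow> real)
     \<Rightarrow> (int \<Rightarrow> 'v) \<Rightarrow> complex \<Rightarrow> 'v" where
  "laurent_val sc S0 N0 S1 N1 b z = (THE y. laurent_sums sc S0 N0 S1 N1 b z y)"

definition has_deriv_sum :: "(complex \<Rightarrow> 'v::ab_group_add \<Rightarrow> 'v) \<Rightarrow> 'v set \<Rightarrow> ('v \<Rightarrow> real) \<Rightarrow> 'v set \<Rightarrow> ('v \<Rightarrow> real)
     \<Rightarrow> (complex \<Rightarrow> 'v) \<Rightarrow> complex \<Rightarrow> 'v \<Rightarrow> bool" where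
  "has_deriv_sum sc S0 N0 S1 N1 F s D \<longleftrightarrow> D \<in> sumspace S0 S1 \<and>
     ((\<lambda>z. sumnorm S0 N0 S1 N1 (sc (1 / (z - s)) (F z - F s) - D)) \<longlongrightarrow> 0) (at s)"

definition in_F :: "(complex \<Rightarrow> 'v::ab_group_add \<Rightarrow> 'v) \<Rightarrow> 'v pseudolat \<Rightarrow> 'v pseudolat
     \<Rightarrow> 'v set \<Rightarrow> ('v \<Rightarrow> real) \<Rightarrow> 'v set \<Rightarrow> ('v \<Rightarrow> real) \<Rightarrow> (complex \<Rightarrow> 'v) \<Rightarrow> bool" where
  "in_F sc X0 X1 S0 N0 S1 N1 g \<longleftrightarrow> (\<exists>b\<in>Jset sc X0 X1 S0 N0 S1 N1.
      \<forall>z\<in>annulus. laurent_sums sc S0 N0 S1 N1 b z (g z))"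

end

theory Submission
  imports Defs
begin

text \<open>Since F(s) = 0, the Laurent coefficients of F(z)/(z - s) can be written in two ways:
  g_n = -\<Sum>_{j\<ge>0} s^(-j-1) f_(n-j), converging in B0 because |s| > 1, and
  g_n = \<Sum>_{j\<ge>0} s^j f_(n+1+j), converging in B1 because the B1-norm of f_m is at most
  e^(-m) times the J-norm and |s| < e. Both satisfy s g_n = g_(n-1) - f_n, and at n = -1 their
  difference is F(s) = 0, so they coincide. The first formula writes {g_n} as a combination of
  shifts of {f_n} with total weight 1/(|s| - 1), the second writes {e^n g_n} as a combination of
  shifts of {e^n f_n} with total weight 1/(e - |s|); translation invariance gives the bound.
  Off s the Laurent series of g telescopes to F(z)/(z - s). Its sum G is continuous, being built
  from power series, so the difference quotients F(z)/(z - s) = G(z) tend to G(s) = F'(s).\<close>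

lemma norm_power_diff_le:
  fixes w w0 :: complex
  assumes "cmod w \<le> r" "cmod w0 \<le> r" "r > 0"
  shows "cmod (w ^ k - w0 ^ k) \<le> real k * r ^ k * cmod (w - w0) / r"
proof -
  have "cmod ((w / r) ^ k - (w0 / r) ^ k) \<le> real k * cmod (w / r - w0 / r)"
    using assms by (intro norm_power_diff) (simp_all add: norm_divide)
  then have "cmod (w ^ k - w0 ^ k) / r ^ k \<le> real k * (cmod (w - w0) / r)"
    using assms(3) by (simp add: power_divide norm_divide norm_power diff_divide_distrib[symmetric])
  then show ?thesis
    using assms(3) by (simp add: field_simps)
qed

lemma summable_of_nat_mult_power:
  fixes x :: real
  assumes "0 \<le> x" "x < 1"
  shows "summable (\<lambda>k. real k * x ^ k)"
proof -
  have "summable (\<lambda>k. diffs (\<lambda>_. 1::real) k * x ^ k)"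
    by (rule termdiff_converges[where K=1]) (use assms in \<open>auto intro: summable_geometric\<close>)
  then have "summable (\<lambda>k. real (Suc k) * x ^ k)"
    by (simp add: diffs_def)
  then show ?thesis
    by (rule summable_comparison_test'[where N=0]) (use assms in \<open>auto intro: mult_right_mono\<close>)
qed

locale complex_banach = vector_space sc for sc :: "complex \<Rightarrow> 'v::ab_group_add \<Rightarrow> 'v" +
  fixes S :: "'v set" and N :: "'v \<Rightarrow> real"
  assumes cbanach: "cbanach sc S N"
begin

lemma zero_mem: "0 \<in> S"
  and add_mem: "x \<in> S \<Longrightarrow> y \<in> S \<Longrightarrow> x + y \<in> S"
  and scale_mem: "x \<in> S \<Longrightarrow> sc c x \<in> S"
  using cbanach unfolding cbanach_def csubspace_def by auto

lemma minus_mem: "x \<in> S \<Longrightarrow> - x \<in> S"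
  using scale_mem[of x "-1"] by simp

lemma diff_mem: "x \<in> S \<Longrightarrow> y \<in> S \<Longrightarrow> x - y \<in> S"
  using add_mem[OF _ minus_mem[of y]] by simp

lemma sum_mem: "(\<And>k. k \<in> A \<Longrightarrow> u k \<in> S) \<Longrightarrow> sum u A \<in> S"
  by (induction A rule: infinite_finite_induct) (auto intro: zero_mem add_mem)

lemma N_nonneg: "x \<in> S \<Longrightarrow> 0 \<le> N x"
  and N_eq_0_iff: "x \<in> S \<Longrightarrow> N x = 0 \<longleftrightarrow> x = 0"
  and N_scale: "x \<in> S \<Longrightarrow> N (sc c x) = cmod c * N x"
  and N_triangle: "x \<in> S \<Longrightarrow> y \<in> S \<Longrightarrow> N (x + y) \<le> N x + N y"
  using cbanach unfolding cbanach_def by auto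

lemma N_zero [simp]: "N 0 = 0"
  using N_eq_0_iff[OF zero_mem] by simp

lemma N_minus: "x \<in> S \<Longrightarrow> N (- x) = N x"
  using N_scale[of x "-1"] by simp

lemma N_minus_commute: "x \<in> S \<Longrightarrow> y \<in> S \<Longrightarrow> N (x - y) = N (y - x)"
  using N_minus[OF diff_mem[of x y]] by simp

lemma N_triangle_diff: "x \<in> S \<Longrightarrow> y \<in> S \<Longrightarrow> z \<in> S \<Longrightarrow> N (x - z) \<le> N (x - y) + N (y - z)"
  using N_triangle[OF diff_mem[of x y] diff_mem[of y z]] by simp

lemma N_sum_le: "(\<And>k. k \<in> A \<Longrightarrow> u k \<in> S) \<Longrightarrow> N (sum u A) \<le> (\<Sum>k\<in>A. N (u k))"
proof (induction A rule: infinite_finite_induct)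
  case (insert k A)
  then have "N (sum u (insert k A)) \<le> N (u k) + N (sum u A)"
    by (simp add: N_triangle sum_mem)
  with insert show ?case by simp
qed auto

lemma Cauchy_converges:
  assumes "\<And>n. u n \<in> S" "\<And>e. e > 0 \<Longrightarrow> \<exists>M. \<forall>m\<ge>M. \<forall>n\<ge>M. N (u m - u n) < e"
  shows "\<exists>x\<in>S. (\<lambda>n. N (u n - x)) \<longlonglongrightarrow> 0"
  using cbanach assms unfolding cbanach_def by blast

lemma N_tendsto_unique:
  assumes "\<forall>\<^sub>F n in F. u n \<in> S" "F \<noteq> bot" "x \<in> S" "y \<in> S"
    and "((\<lambda>n. N (u n - x)) \<longlongrightarrow> 0) F" "((\<lambda>n. N (u n - y)) \<longlongrightarrow> 0) F"
  shows "x = y"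
proof -
  have "\<forall>\<^sub>F n in F. N (x - y) \<le> N (u n - x) + N (u n - y)"
    using assms(1) by eventually_elim (metis N_triangle_diff N_minus_commute assms(3,4))
  moreover have "((\<lambda>n. N (u n - x) + N (u n - y)) \<longlongrightarrow> 0) F"
    using tendsto_add[OF assms(5,6)] by simp
  ultimately have "N (x - y) \<le> 0"
    using assms(2) by (intro tendsto_le[OF _ _ tendsto_const]) auto
  then show ?thesis
    using N_nonneg N_eq_0_iff diff_mem assms(3,4) by (metis antisym eq_iff_diff_eq_0)
qed

lemma N_tendsto_scale:
  assumes "\<And>n. u n \<in> S" "x \<in> S" "((\<lambda>n. N (u n - x)) \<longlongrightarrow> 0) F"
  shows "((\<lambda>n. N (sc c (u n) - sc c x)) \<longlongrightarrow> 0) F"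
proof -
  have "N (sc c (u n) - sc c x) = cmod c * N (u n - x)" for n
    using N_scale[OF diff_mem[OF assms(1,2)]] by (simp add: scale_right_diff_distrib)
  then show ?thesis
    using tendsto_mult_right_zero[OF assms(3)] by simp
qed

definition limit :: "(nat \<Rightarrow> 'v) \<Rightarrow> 'v" where
  "limit u = (SOME x. x \<in> S \<and> (\<lambda>n. N (u n - x)) \<longlonglongrightarrow> 0)"

lemma limit_eq:
  assumes "\<And>n. u n \<in> S" "x \<in> S" "(\<lambda>n. N (u n - x)) \<longlonglongrightarrow> 0"
  shows "limit u = x"
proof -
  have "limit u \<in> S \<and> (\<lambda>n. N (u n - limit u)) \<longlonglongrightarrow> 0"
    unfolding limit_def by (rule someI[of _ x]) (use assms in auto)
  then show ?thesis
    using N_tendsto_unique[of u sequentially] assms by auto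
qed

lemma partial_sums_converge:
  assumes u: "\<And>k. u k \<in> S" and a: "\<And>k. N (u k) \<le> a k" and sa: "summable a"
  shows "\<exists>x\<in>S. (\<lambda>n. N ((\<Sum>k<n. u k) - x)) \<longlonglongrightarrow> 0"
proof (rule Cauchy_converges)
  have ps: "(\<Sum>k<n. u k) \<in> S" for n
    by (rule sum_mem) (use u in auto)
  then show "(\<Sum>k<n. u k) \<in> S" for n .
  have ps_le: "N (\<Sum>k\<in>A. u k) \<le> sum a A" for A
    using N_sum_le[of A u] u a sum_mono[of A "\<lambda>k. N (u k)" a] by force
  have diff: "N ((\<Sum>k<m. u k) - (\<Sum>k<n. u k)) \<le> \<bar>sum a {min m n..<max m n}\<bar>" for m n
  proof (cases "n \<le> m")
    case True
    then show ?thesis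
      using ps_le[of "{n..<m}"] sum_diff_nat_ivl[of 0 n m u] by (simp add: lessThan_atLeast0)
  next
    case False
    then show ?thesis
      using ps_le[of "{m..<n}"] sum_diff_nat_ivl[of 0 m n u] N_minus_commute[OF ps ps, of m n]
      by (simp add: lessThan_atLeast0)
  qed
  fix e :: real
  assume "e > 0"
  then obtain M where M: "\<forall>m\<ge>M. \<forall>n. \<bar>sum a {m..<n}\<bar> < e"
    using sa unfolding summable_Cauchy by auto
  show "\<exists>M. \<forall>m\<ge>M. \<forall>n\<ge>M. N ((\<Sum>k<m. u k) - (\<Sum>k<n. u k)) < e"
  proof (intro exI allI impI)
    fix m n
    assume "M \<le> m" "M \<le> n"
    then have "\<bar>sum a {min m n..<max m n}\<bar> < e"
      using M by simp
    then show "N ((\<Sum>k<m. u k) - (\<Sum>k<n. u k)) < e"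
      using diff[of m n] by linarith
  qed
qed

lemma series_comparison_converges:
  assumes u: "\<And>k. u k \<in> S" and a: "\<And>k. N (u k) \<le> a k" and sa: "summable a"
  shows "\<exists>x\<in>S. (\<lambda>n. N ((\<Sum>k<n. u k) - x)) \<longlonglongrightarrow> 0 \<and> N x \<le> suminf a"
proof -
  obtain x where x: "x \<in> S" "(\<lambda>n. N ((\<Sum>k<n. u k) - x)) \<longlonglongrightarrow> 0"
    using partial_sums_converge[OF assms] by blast
  have ps: "(\<Sum>k<n. u k) \<in> S" for n
    by (rule sum_mem) (use u in auto)
  have "N x \<le> N ((\<Sum>k<n. u k) - x) + suminf a" for n
  proof -
    have "N x \<le> N (x - (\<Sum>k<n. u k)) + N (\<Sum>k<n. u k)"
      using N_triangle[OF diff_mem[OF x(1) ps[of n]] ps[of n]] by simp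
    also have "N (\<Sum>k<n. u k) \<le> (\<Sum>k<n. a k)"
      using N_sum_le[of "{..<n}" u] u a sum_mono[of "{..<n}" "\<lambda>k. N (u k)" a] by force
    also have "\<dots> \<le> suminf a"
      using sa a N_nonneg[OF u] by (intro sum_le_suminf) (auto intro: order_trans)
    finally show ?thesis
      using N_minus_commute[OF x(1) ps] by simp
  qed
  then have "N x \<le> 0 + suminf a"
    by (intro tendsto_le[OF _ tendsto_add[OF x(2) tendsto_const] tendsto_const]) auto
  with x show ?thesis
    by auto
qed

definition pseries :: "(nat \<Rightarrow> 'v) \<Rightarrow> complex \<Rightarrow> 'v" where
  "pseries c w = limit (\<lambda>n. \<Sum>k<n. sc (w ^ k) (c k))"

context
  fixes c :: "nat \<Rightarrow> 'v" and C q :: real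
  assumes c_mem: "\<And>k. c k \<in> S" and c_bound: "\<And>k. N (c k) \<le> C * q ^ k" and q_pos: "q > 0"
begin

lemma partial_sum_mem: "(\<Sum>k<n. sc (w ^ k) (c k)) \<in> S"
  by (intro sum_mem scale_mem c_mem)

lemma pseries_converges:
  assumes "cmod w * q < 1"
  shows "pseries c w \<in> S \<and> (\<lambda>n. N ((\<Sum>k<n. sc (w ^ k) (c k)) - pseries c w)) \<longlonglongrightarrow> 0"
proof -
  have "N (sc (w ^ k) (c k)) \<le> C * (cmod w * q) ^ k" for k
    using mult_left_mono[OF c_bound[of k] norm_ge_zero[of "w ^ k"]]
    by (simp add: N_scale[OF c_mem] norm_power power_mult_distrib mult_ac)
  moreover have "summable (\<lambda>k. C * (cmod w * q) ^ k)"
    using assms q_pos by (intro summable_mult summable_geometric) auto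
  ultimately obtain x where x: "x \<in> S" "(\<lambda>n. N ((\<Sum>k<n. sc (w ^ k) (c k)) - x)) \<longlonglongrightarrow> 0"
    using series_comparison_converges[of "\<lambda>k. sc (w ^ k) (c k)" "\<lambda>k. C * (cmod w * q) ^ k"]
      scale_mem[OF c_mem] by meson
  have "pseries c w = x"
    unfolding pseries_def using partial_sum_mem x by (rule limit_eq)
  with x show ?thesis
    by simp
qed

lemma pseries_mem: "cmod w * q < 1 \<Longrightarrow> pseries c w \<in> S"
  using pseries_converges by blast

lemma partial_sum_lipschitz:
  assumes r: "r > 0" "r * q < 1" and w: "cmod w \<le> r" "cmod w0 \<le> r"
  shows "N ((\<Sum>k<n. sc (w ^ k) (c k)) - (\<Sum>k<n. sc (w0 ^ k) (c k)))
    \<le> cmod (w - w0) * (C / r * (\<Sum>k. real k * (r * q) ^ k))"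
proof -
  have C: "C \<ge> 0"
    using c_bound[of 0] N_nonneg[OF c_mem[of 0]] by simp
  have "N ((\<Sum>k<n. sc (w ^ k) (c k)) - (\<Sum>k<n. sc (w0 ^ k) (c k)))
      = N (\<Sum>k<n. sc (w ^ k - w0 ^ k) (c k))"
    by (simp add: sum_subtractf scale_left_diff_distrib)
  also have "\<dots> \<le> (\<Sum>k<n. cmod (w ^ k - w0 ^ k) * N (c k))"
    using N_sum_le[of "{..<n}" "\<lambda>k. sc (w ^ k - w0 ^ k) (c k)"] by (simp add: N_scale c_mem scale_mem)
  also have "\<dots> \<le> (\<Sum>k<n. cmod (w - w0) * (C / r) * (real k * (r * q) ^ k))"
  proof (rule sum_mono)
    fix k
    have "cmod (w ^ k - w0 ^ k) * N (c k) \<le> (real k * r ^ k * cmod (w - w0) / r) * (C * q ^ k)"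
      using norm_power_diff_le[OF w r(1)] c_bound N_nonneg[OF c_mem] r by (intro mult_mono) auto
    then show "cmod (w ^ k - w0 ^ k) * N (c k) \<le> cmod (w - w0) * (C / r) * (real k * (r * q) ^ k)"
      by (simp add: power_mult_distrib mult_ac)
  qed
  also have "\<dots> = cmod (w - w0) * (C / r) * (\<Sum>k<n. real k * (r * q) ^ k)"
    by (simp add: sum_distrib_left)
  also have "\<dots> \<le> cmod (w - w0) * (C / r * (\<Sum>k. real k * (r * q) ^ k))"
    unfolding mult.assoc
    using summable_of_nat_mult_power[of "r * q"] r q_pos C
    by (intro mult_left_mono sum_le_suminf) auto
  finally show ?thesis .
qed

lemma pseries_lipschitz:
  assumes r: "r > 0" "r * q < 1" and w: "cmod w \<le> r" "cmod w0 \<le> r"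
  shows "N (pseries c w - pseries c w0) \<le> cmod (w - w0) * (C / r * (\<Sum>k. real k * (r * q) ^ k))"
    (is "_ \<le> ?L")
proof -
  let ?p = "\<lambda>w n. \<Sum>k<n. sc (w ^ k) (c k)"
  have "cmod v * q < 1" if "cmod v \<le> r" for v
    using that r q_pos by (meson le_less_trans mult_right_mono less_imp_le)
  then have P: "pseries c w \<in> S" "(\<lambda>n. N (?p w n - pseries c w)) \<longlonglongrightarrow> 0"
    and P0: "pseries c w0 \<in> S" "(\<lambda>n. N (?p w0 n - pseries c w0)) \<longlonglongrightarrow> 0"
    using pseries_converges w by auto
  have "N (pseries c w - pseries c w0) \<le> N (?p w n - pseries c w) + ?L + N (?p w0 n - pseries c w0)" for n
  proof -
    have "?p w n \<in> S" "?p w0 n \<in> S"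
      by (rule partial_sum_mem)+
    then show ?thesis
      using N_triangle_diff[OF P(1) \<open>?p w n \<in> S\<close> P0(1)] partial_sum_lipschitz[OF r w, of n]
        N_triangle_diff[OF \<open>?p w n \<in> S\<close> \<open>?p w0 n \<in> S\<close> P0(1)]
        N_minus_commute[OF P(1) \<open>?p w n \<in> S\<close>]
      by linarith
  qed
  moreover have "(\<lambda>n. N (?p w n - pseries c w) + ?L + N (?p w0 n - pseries c w0)) \<longlonglongrightarrow> 0 + ?L + 0"
    using P P0 by (intro tendsto_add tendsto_const)
  ultimately show ?thesis
    by (intro tendsto_le[OF _ _ tendsto_const]) auto
qed

lemma pseries_tendsto:
  assumes w0: "cmod w0 * q < 1" and lim: "(w \<longlongrightarrow> w0) F"
  shows "((\<lambda>x. N (pseries c (w x) - pseries c w0)) \<longlongrightarrow> 0) F"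
proof -
  define r where "r = (cmod w0 + 1 / q) / 2"
  have r: "r > 0" "cmod w0 < r" "r * q < 1"
    using w0 q_pos by (auto simp: r_def field_simps add_pos_nonneg)
  define L where "L = C / r * (\<Sum>k. real k * (r * q) ^ k)"
  have near: "\<forall>\<^sub>F x in F. cmod (w x) \<le> r"
  proof -
    have "\<forall>\<^sub>F x in F. dist (w x) w0 < r - cmod w0"
      using lim r(2) by (simp add: tendsto_iff)
    then show ?thesis
      by eventually_elim (smt (verit) dist_norm norm_triangle_sub)
  qed
  show ?thesis
  proof (rule tendsto_sandwich[OF _ _ tendsto_const])
    show "\<forall>\<^sub>F x in F. 0 \<le> N (pseries c (w x) - pseries c w0)"
      using near
    proof eventually_elim
      case (elim x)
      then have "cmod (w x) * q < 1"
        using r q_pos by (meson le_less_trans mult_right_mono less_imp_le)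
      then show ?case
        using w0 by (intro N_nonneg diff_mem pseries_mem)
    qed
    show "\<forall>\<^sub>F x in F. N (pseries c (w x) - pseries c w0) \<le> cmod (w x - w0) * L"
      using near unfolding L_def
      by eventually_elim (rule pseries_lipschitz[OF r(1,3)], simp_all add: less_imp_le[OF r(2)])
    show "((\<lambda>x. cmod (w x - w0) * L) \<longlongrightarrow> 0) F"
      using tendsto_mult_left_zero[OF tendsto_norm_zero[OF LIM_zero[OF lim]]] .
  qed
qed

end

lemma pseries_unfold:
  assumes c: "\<And>k. c k \<in> S" "\<And>k. N (c k) \<le> C * q ^ k" and q: "q > 0" and w: "cmod w * q < 1"
  shows "pseries c w = c 0 + sc w (pseries (\<lambda>k. c (Suc k)) w)"
proof -
  let ?c' = "\<lambda>k. c (Suc k)" and ?p = "\<lambda>c n. \<Sum>k<n. sc (w ^ k) (c k)"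
  have c': "?c' k \<in> S" "N (?c' k) \<le> (C * q) * q ^ k" for k
    using c(1) c(2)[of "Suc k"] by (simp_all add: mult_ac)
  note P' = pseries_converges[OF c' q w]
  let ?x = "c 0 + sc w (pseries ?c' w)"
  have "?p c (Suc n) = c 0 + sc w (?p ?c' n)" for n
    unfolding sum.lessThan_Suc_shift by (simp add: scale_sum_right)
  then have shift: "?p c (Suc n) - ?x = sc w (?p ?c' n) - sc w (pseries ?c' w)" for n
    by simp
  have "(\<lambda>n. N (sc w (?p ?c' n) - sc w (pseries ?c' w))) \<longlonglongrightarrow> 0"
    using P' partial_sum_mem[OF c' q] by (intro N_tendsto_scale) auto
  then have "(\<lambda>n. N (?p c (Suc n) - ?x)) \<longlonglongrightarrow> 0"
    unfolding shift .
  then have "(\<lambda>n. N (?p c n - ?x)) \<longlonglongrightarrow> 0"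
    by (rule LIMSEQ_imp_Suc)
  moreover have "?x \<in> S"
    using P' c by (intro add_mem scale_mem) auto
  ultimately show ?thesis
    using pseries_converges[OF c q w] partial_sum_mem[OF c q]
    by (intro N_tendsto_unique[of "?p c" sequentially]) auto
qed

end

locale banach_couple_space = vector_space sc for sc :: "complex \<Rightarrow> 'v::ab_group_add \<Rightarrow> 'v" +
  fixes S0 :: "'v set" and N0 :: "'v \<Rightarrow> real" and S1 :: "'v set" and N1 :: "'v \<Rightarrow> real"
  assumes banach_couple: "banach_couple sc S0 N0 S1 N1"
begin

sublocale B0: complex_banach sc S0 N0
  using banach_couple by unfold_locales (simp add: banach_couple_def)

sublocale B1: complex_banach sc S1 N1
  using banach_couple by unfold_locales (simp add: banach_couple_def)

abbreviation "Ssum \<equiv> sumspace S0 S1"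
abbreviation "Nsum \<equiv> sumnorm S0 N0 S1 N1"

lemma sumspace_add: "a \<in> S0 \<Longrightarrow> b \<in> S1 \<Longrightarrow> a + b \<in> Ssum"
  unfolding sumspace_def by blast

lemma sumspace_mem0: "a \<in> S0 \<Longrightarrow> a \<in> Ssum"
  using sumspace_add[of a 0] B1.zero_mem by simp

lemma sumspace_mem1: "b \<in> S1 \<Longrightarrow> b \<in> Ssum"
  using sumspace_add[of 0 b] B0.zero_mem by simp

lemma sumspace_cases:
  assumes "x \<in> Ssum"
  obtains a b where "a \<in> S0" "b \<in> S1" "x = a + b"
  using assms unfolding sumspace_def by blast

lemma add_mem:
  assumes "x \<in> Ssum" "y \<in> Ssum"
  shows "x + y \<in> Ssum"
proof -
  obtain a b a' b' where "a \<in> S0" "b \<in> S1" "x = a + b" "a' \<in> S0" "b' \<in> S1" "y = a' + b'"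
    using assms by (metis sumspace_cases)
  then have "(a + a') + (b + b') \<in> Ssum"
    by (simp add: sumspace_add B0.add_mem B1.add_mem)
  then show ?thesis
    using \<open>x = a + b\<close> \<open>y = a' + b'\<close> by (simp add: algebra_simps)
qed

lemma scale_mem: "x \<in> Ssum \<Longrightarrow> sc c x \<in> Ssum"
  by (elim sumspace_cases) (simp add: scale_right_distrib sumspace_add B0.scale_mem B1.scale_mem)

lemma diff_mem: "x \<in> Ssum \<Longrightarrow> y \<in> Ssum \<Longrightarrow> x - y \<in> Ssum"
  using add_mem[OF _ scale_mem[of y "-1"]] by simp

lemma sum_mem: "(\<And>k. k \<in> A \<Longrightarrow> u k \<in> Ssum) \<Longrightarrow> sum u A \<in> Ssum"
  by (induction A rule: infinite_finite_induct) (auto intro: sumspace_mem0 B0.zero_mem add_mem)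

lemma Nsum_le: "a \<in> S0 \<Longrightarrow> b \<in> S1 \<Longrightarrow> Nsum (a + b) \<le> N0 a + N1 b"
  unfolding sumnorm_def
  by (rule cInf_lower) (auto intro!: bdd_belowI[of _ 0] add_nonneg_nonneg B0.N_nonneg B1.N_nonneg)

lemma Nsum_le0: "a \<in> S0 \<Longrightarrow> Nsum a \<le> N0 a"
  using Nsum_le[of a 0] B1.zero_mem by simp

lemma Nsum_le1: "b \<in> S1 \<Longrightarrow> Nsum b \<le> N1 b"
  using Nsum_le[of 0 b] B0.zero_mem by simp

lemma Nsum_greatest:
  "x \<in> Ssum \<Longrightarrow> (\<And>a b. a \<in> S0 \<Longrightarrow> b \<in> S1 \<Longrightarrow> x = a + b \<Longrightarrow> t \<le> N0 a + N1 b) \<Longrightarrow> t \<le> Nsum x"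
  unfolding sumnorm_def by (rule cInf_greatest) (auto simp: sumspace_def)

lemma Nsum_nonneg: "x \<in> Ssum \<Longrightarrow> 0 \<le> Nsum x"
  by (rule Nsum_greatest) (auto intro!: add_nonneg_nonneg B0.N_nonneg B1.N_nonneg)

lemma Nsum_triangle:
  assumes x: "x \<in> Ssum" and y: "y \<in> Ssum"
  shows "Nsum (x + y) \<le> Nsum x + Nsum y"
proof -
  have "Nsum (x + y) - (N0 a' + N1 b') \<le> Nsum x" if "a' \<in> S0" "b' \<in> S1" "y = a' + b'" for a' b'
  proof (rule Nsum_greatest[OF x])
    fix a b
    assume ab: "a \<in> S0" "b \<in> S1" "x = a + b"
    have "x + y = (a + a') + (b + b')"
      using ab that by (simp add: algebra_simps)
    then have "Nsum (x + y) \<le> N0 (a + a') + N1 (b + b')"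
      using Nsum_le ab that B0.add_mem B1.add_mem by metis
    also have "\<dots> \<le> (N0 a + N0 a') + (N1 b + N1 b')"
      using ab that by (intro add_mono B0.N_triangle B1.N_triangle)
    finally show "Nsum (x + y) - (N0 a' + N1 b') \<le> N0 a + N1 b"
      by simp
  qed
  then have "Nsum (x + y) - Nsum x \<le> Nsum y"
    by (intro Nsum_greatest[OF y]) force
  then show ?thesis
    by simp
qed

lemma Nsum_scale_le:
  assumes x: "x \<in> Ssum"
  shows "Nsum (sc c x) \<le> cmod c * Nsum x"
proof (cases "c = 0")
  case True
  then show ?thesis
    using Nsum_le[of 0 0] B0.zero_mem B1.zero_mem Nsum_nonneg[OF x] by simp
next
  case False
  have "Nsum (sc c x) / cmod c \<le> Nsum x"
  proof (rule Nsum_greatest[OF x])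
    fix a b
    assume ab: "a \<in> S0" "b \<in> S1" "x = a + b"
    have "Nsum (sc c x) \<le> N0 (sc c a) + N1 (sc c b)"
      using Nsum_le[OF B0.scale_mem[OF ab(1)] B1.scale_mem[OF ab(2)]] ab(3)
      by (simp add: scale_right_distrib)
    also have "\<dots> = cmod c * (N0 a + N1 b)"
      using ab B0.N_scale B1.N_scale by (simp add: algebra_simps)
    finally show "Nsum (sc c x) / cmod c \<le> N0 a + N1 b"
      using False by (simp add: field_simps)
  qed
  then show ?thesis
    using False by (simp add: field_simps)
qed

lemma Nsum_minus_commute: "x \<in> Ssum \<Longrightarrow> y \<in> Ssum \<Longrightarrow> Nsum (x - y) = Nsum (y - x)"
  using Nsum_scale_le[of "x - y" "-1"] Nsum_scale_le[of "y - x" "-1"] diff_mem by fastforce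

lemma Nsum_eq_0: "x \<in> Ssum \<Longrightarrow> Nsum x = 0 \<Longrightarrow> x = 0"
  using banach_couple unfolding banach_couple_def by blast

lemma Nsum_tendsto_unique:
  assumes "\<forall>\<^sub>F n in F. u n \<in> Ssum" "F \<noteq> bot" "x \<in> Ssum" "y \<in> Ssum"
    and "((\<lambda>n. Nsum (u n - x)) \<longlongrightarrow> 0) F" "((\<lambda>n. Nsum (u n - y)) \<longlongrightarrow> 0) F"
  shows "x = y"
proof -
  have "\<forall>\<^sub>F n in F. Nsum (x - y) \<le> Nsum (u n - x) + Nsum (u n - y)"
    using assms(1)
  proof eventually_elim
    case (elim n)
    then show ?case
      using Nsum_triangle[of "x - u n" "u n - y"] Nsum_minus_commute[of x "u n"] diff_mem assms(3,4)
      by simp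
  qed
  moreover have "((\<lambda>n. Nsum (u n - x) + Nsum (u n - y)) \<longlongrightarrow> 0) F"
    using tendsto_add[OF assms(5,6)] by simp
  ultimately have "Nsum (x - y) \<le> 0"
    using assms(2) by (intro tendsto_le[OF _ _ tendsto_const]) auto
  then show ?thesis
    using Nsum_nonneg Nsum_eq_0 diff_mem assms(3,4) by (metis antisym eq_iff_diff_eq_0)
qed

lemma has_deriv_sum_unique:
  assumes "\<forall>\<^sub>F z in at s. F z \<in> Ssum" "F s \<in> Ssum"
    and "has_deriv_sum sc S0 N0 S1 N1 F s D" "has_deriv_sum sc S0 N0 S1 N1 F s D'"
  shows "D = D'"
  using assms unfolding has_deriv_sum_def
  by (intro Nsum_tendsto_unique[of "\<lambda>z. sc (1 / (z - s)) (F z - F s)" "at s"])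
     (auto elim!: eventually_mono intro: scale_mem diff_mem)

lemma Nsum_tendsto_add:
  assumes "\<forall>\<^sub>F n in F. u n \<in> Ssum \<and> v n \<in> Ssum" "x \<in> Ssum" "y \<in> Ssum"
    and "((\<lambda>n. Nsum (u n - x)) \<longlongrightarrow> 0) F" "((\<lambda>n. Nsum (v n - y)) \<longlongrightarrow> 0) F"
  shows "((\<lambda>n. Nsum ((u n + v n) - (x + y))) \<longlongrightarrow> 0) F"
proof (rule tendsto_sandwich[OF _ _ tendsto_const tendsto_add[OF assms(4,5)], simplified])
  show "\<forall>\<^sub>F n in F. 0 \<le> Nsum (u n + v n - (x + y))"
    using assms(1) by eventually_elim (use assms(2,3) in \<open>intro Nsum_nonneg diff_mem add_mem, auto\<close>)
  show "\<forall>\<^sub>F n in F. Nsum (u n + v n - (x + y)) \<le> Nsum (u n - x) + Nsum (v n - y)"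
    using assms(1)
  proof eventually_elim
    case (elim n)
    then show ?case
      using Nsum_triangle[of "u n - x" "v n - y"] diff_mem assms(2,3) by (simp add: algebra_simps)
  qed
qed

lemma Nsum_tendsto_scale:
  assumes "\<forall>\<^sub>F n in F. u n \<in> Ssum" "x \<in> Ssum" "((\<lambda>n. Nsum (u n - x)) \<longlongrightarrow> 0) F"
  shows "((\<lambda>n. Nsum (sc c (u n) - sc c x)) \<longlongrightarrow> 0) F"
proof (rule tendsto_sandwich[OF _ _ tendsto_const tendsto_mult_right_zero[OF assms(3)]])
  show "\<forall>\<^sub>F n in F. 0 \<le> Nsum (sc c (u n) - sc c x)"
    using assms(1) by eventually_elim (use assms(2) in \<open>intro Nsum_nonneg diff_mem scale_mem\<close>)
  show "\<forall>\<^sub>F n in F. Nsum (sc c (u n) - sc c x) \<le> cmod c * Nsum (u n - x)"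
    using assms(1) by eventually_elim (metis Nsum_scale_le diff_mem assms(2) scale_right_diff_distrib)
qed

lemma Nsum_tendsto_of_N0:
  assumes "\<forall>\<^sub>F n in F. u n \<in> S0" "x \<in> S0" "((\<lambda>n. N0 (u n - x)) \<longlongrightarrow> 0) F"
  shows "((\<lambda>n. Nsum (u n - x)) \<longlongrightarrow> 0) F"
proof (rule tendsto_sandwich[OF _ _ tendsto_const assms(3)])
  show "\<forall>\<^sub>F n in F. 0 \<le> Nsum (u n - x)" "\<forall>\<^sub>F n in F. Nsum (u n - x) \<le> N0 (u n - x)"
    using assms(1,2) by (auto elim!: eventually_mono
        intro!: Nsum_nonneg Nsum_le0 sumspace_mem0 B0.diff_mem)
qed

lemma Nsum_tendsto_of_N1:
  assumes "\<forall>\<^sub>F n in F. u n \<in> S1" "x \<in> S1" "((\<lambda>n. N1 (u n - x)) \<longlongrightarrow> 0) F"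
  shows "((\<lambda>n. Nsum (u n - x)) \<longlongrightarrow> 0) F"
proof (rule tendsto_sandwich[OF _ _ tendsto_const assms(3)])
  show "\<forall>\<^sub>F n in F. 0 \<le> Nsum (u n - x)" "\<forall>\<^sub>F n in F. Nsum (u n - x) \<le> N1 (u n - x)"
    using assms(1,2) by (auto elim!: eventually_mono
        intro!: Nsum_nonneg Nsum_le1 sumspace_mem1 B1.diff_mem)
qed

end

lemma sum_apply: "(\<Sum>j\<in>A. u j) x = (\<Sum>j\<in>A. u j x)"
  by (induction A rule: infinite_finite_induct) auto

lemma vector_space_seqscale: "vector_space sc \<Longrightarrow> vector_space (seqscale sc)"
  unfolding vector_space_def seqscale_def by (auto simp: fun_eq_iff)

locale pseudolattice_on = complex_banach sc S N for sc :: "complex \<Rightarrow> 'v::ab_group_add \<Rightarrow> 'v" and S N +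
  fixes X :: "'v pseudolat"
  assumes pseudolattice: "pseudolattice sc X"
    and translation_invariant: "translation_invariant sc X"
begin

abbreviation "XS \<equiv> fst (X S N)"
abbreviation "XN \<equiv> snd (X S N)"

sublocale seq: complex_banach "seqscale sc" XS XN
  using pseudolattice cbanach
  by (intro complex_banach.intro vector_space_seqscale vector_space_axioms)
     (simp add: complex_banach_axioms_def pseudolattice_def)

lemma coord_mem: "b \<in> XS \<Longrightarrow> b n \<in> S"
  using pseudolattice cbanach unfolding pseudolattice_def by blast

lemma N_coord_le: "b \<in> XS \<Longrightarrow> N (b n) \<le> XN b"
  using pseudolattice cbanach unfolding pseudolattice_def by blast

lemma shift_mem: "b \<in> XS \<Longrightarrow> (\<lambda>n. b (n + k)) \<in> XS"
  and XN_shift: "b \<in> XS \<Longrightarrow> XN (\<lambda>n. b (n + k)) = XN b"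
  using translation_invariant cbanach unfolding translation_invariant_def by blast+

lemma coord_tendsto:
  assumes "\<And>m. u m \<in> XS" "x \<in> XS" "(\<lambda>m. XN (u m - x)) \<longlonglongrightarrow> 0"
  shows "(\<lambda>m. N (u m n - x n)) \<longlonglongrightarrow> 0"
proof (rule tendsto_sandwich[OF always_eventually always_eventually tendsto_const assms(3)])
  show "\<forall>m. 0 \<le> N (u m n - x n)"
    using assms coord_mem by (auto intro!: N_nonneg diff_mem)
  show "\<forall>m. N (u m n - x n) \<le> XN (u m - x)"
    using N_coord_le[OF seq.diff_mem[OF assms(1,2)]] by simp
qed

lemma shift_series_mem:
  assumes b: "b \<in> XS" and \<kappa>: "summable (\<lambda>j. cmod (\<kappa> j))"
    and G: "\<And>n. G n \<in> S" "\<And>n. (\<lambda>m. N ((\<Sum>j<m. sc (\<kappa> j) (b (n + k j))) - G n)) \<longlonglongrightarrow> 0"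
  shows "G \<in> XS \<and> XN G \<le> (\<Sum>j. cmod (\<kappa> j)) * XN b"
proof -
  define u where "u j = seqscale sc (\<kappa> j) (\<lambda>n. b (n + k j))" for j
  have u: "u j \<in> XS" "XN (u j) = cmod (\<kappa> j) * XN b" for j
    using b by (simp_all add: u_def seq.scale_mem seq.N_scale shift_mem XN_shift)
  obtain H where H: "H \<in> XS" "(\<lambda>m. XN ((\<Sum>j<m. u j) - H)) \<longlonglongrightarrow> 0"
    "XN H \<le> (\<Sum>j. cmod (\<kappa> j) * XN b)"
    using seq.series_comparison_converges[of u "\<lambda>j. cmod (\<kappa> j) * XN b"] u(1) u(2)[THEN eq_refl]
      summable_mult2[OF \<kappa>] by blast
  have partial: "(\<Sum>j<m. u j) \<in> XS" for m
    by (intro seq.sum_mem u)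
  have "H n = G n" for n
  proof (rule N_tendsto_unique[of "\<lambda>m. (\<Sum>j<m. u j) n" sequentially])
    show "\<forall>\<^sub>F m in sequentially. (\<Sum>j<m. u j) n \<in> S"
      using partial coord_mem by (intro always_eventually) blast
    show "H n \<in> S" "G n \<in> S"
      using coord_mem[OF H(1)] G(1) by blast+
    show "(\<lambda>m. N ((\<Sum>j<m. u j) n - H n)) \<longlonglongrightarrow> 0"
      using coord_tendsto[OF partial H(1,2)] .
    show "(\<lambda>m. N ((\<Sum>j<m. u j) n - G n)) \<longlonglongrightarrow> 0"
      using G(2) by (simp add: sum_apply u_def seqscale_def)
  qed simp
  then have "G = H"
    by auto
  then show ?thesis
    using H suminf_mult2[OF \<kappa>] by simp
qed

end

lemma sum_symmetric_int_split:
  fixes h :: "int \<Rightarrow> 'a::ab_group_add"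
  shows "(\<Sum>n\<in>{- int K..int K}. h n)
    = (\<Sum>k<Suc K. h (int k)) + (\<Sum>k<Suc K. if k = 0 then 0 else h (- int k))"
proof (induction K)
  case (Suc K)
  have "{- int (Suc K)..int (Suc K)} = insert (int (Suc K)) (insert (- int (Suc K)) {- int K..int K})"
    by auto
  then have "(\<Sum>n\<in>{- int (Suc K)..int (Suc K)}. h n)
      = h (int (Suc K)) + (h (- int (Suc K)) + (\<Sum>n\<in>{- int K..int K}. h n))"
    by simp
  then show ?case
    unfolding Suc by (simp only: sum.lessThan_Suc) (simp add: algebra_simps)
qed simp

lemma sum_symmetric_int_telescope:
  fixes h :: "int \<Rightarrow> 'a::ab_group_add"
  shows "(\<Sum>n\<in>{- int K..int K}. h n - h (n - 1)) = h (int K) - h (- int K - 1)"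
proof (induction K)
  case (Suc K)
  have "{- int (Suc K)..int (Suc K)} = insert (int (Suc K)) (insert (- int (Suc K)) {- int K..int K})"
    by auto
  then have "(\<Sum>n\<in>{- int (Suc K)..int (Suc K)}. h n - h (n - 1))
      = (h (int (Suc K)) - h (int K)) + ((h (- int (Suc K)) - h (- int (Suc K) - 1))
        + (\<Sum>n\<in>{- int K..int K}. h n - h (n - 1)))"
    by simp
  also have "\<dots> = h (int (Suc K)) - h (- int (Suc K) - 1)"
  proof -
    have "- int (Suc K) = - int K - 1"
      by simp
    then show ?thesis
      unfolding Suc by (simp only:) (simp add: algebra_simps)
  qed
  finally show ?case .
qed simp

lemma annulusD: "z \<in> annulus \<Longrightarrow> 1 < cmod z \<and> cmod z < exp 1"
  unfolding annulus_def by auto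

text \<open>In the form required by pseries_converges, with q = e^(-1) and q = 1.\<close>

lemma annulus_radius: "z \<in> annulus \<Longrightarrow> cmod z * exp (- 1) < 1" "z \<in> annulus \<Longrightarrow> cmod (1 / z) * 1 < 1"
  using annulusD[of z] by (simp_all add: exp_minus field_simps norm_divide divide_less_eq_1)

lemma open_annulus: "open annulus"
  unfolding annulus_def by (intro open_Collect_conj open_Collect_less continuous_intros)

locale J_space = banach_couple_space sc S0 N0 S1 N1
  for sc :: "complex \<Rightarrow> 'v::ab_group_add \<Rightarrow> 'v" and S0 N0 S1 N1 +
  fixes X0 X1 :: "'v pseudolat"
  assumes pseudolattice0: "pseudolattice sc X0" and pseudolattice1: "pseudolattice sc X1"
    and translation_invariant0: "translation_invariant sc X0"
    and translation_invariant1: "translation_invariant sc X1"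
begin

sublocale X0: pseudolattice_on sc S0 N0 X0
  by unfold_locales (fact pseudolattice0 translation_invariant0)+

sublocale X1: pseudolattice_on sc S1 N1 X1
  by unfold_locales (fact pseudolattice1 translation_invariant1)+

abbreviation "J \<equiv> Jset sc X0 X1 S0 N0 S1 N1"
abbreviation "lsums \<equiv> laurent_sums sc S0 N0 S1 N1"
abbreviation "lval \<equiv> laurent_val sc S0 N0 S1 N1"

definition exp_weight :: "(int \<Rightarrow> 'v) \<Rightarrow> int \<Rightarrow> 'v" where
  "exp_weight b = (\<lambda>n. sc (complex_of_real (exp (real_of_int n))) (b n))"

lemma J_iff: "b \<in> J \<longleftrightarrow> (\<forall>n. b n \<in> S0 \<and> b n \<in> S1) \<and> b \<in> X0.XS \<and> exp_weight b \<in> X1.XS"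
  unfolding Jset_def exp_weight_def by auto

lemma Jnorm_eq: "Jnorm sc X0 X1 S0 N0 S1 N1 b = max (X0.XN b) (X1.XN (exp_weight b))"
  unfolding Jnorm_def exp_weight_def ..

definition regular_part :: "(int \<Rightarrow> 'v) \<Rightarrow> complex \<Rightarrow> 'v" where
  "regular_part b z = B1.pseries (\<lambda>k. b (int k)) z"

definition principal_coeff :: "(int \<Rightarrow> 'v) \<Rightarrow> nat \<Rightarrow> 'v" where
  "principal_coeff b k = (if k = 0 then 0 else b (- int k))"

definition principal_part :: "(int \<Rightarrow> 'v) \<Rightarrow> complex \<Rightarrow> 'v" where
  "principal_part b z = B0.pseries (principal_coeff b) (1 / z)"

context
  fixes b assumes b: "b \<in> J"
begin

lemma J_mem0: "b n \<in> S0" and J_mem1: "b n \<in> S1" and J_mem: "b n \<in> Ssum"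
  using b sumspace_mem0 by (auto simp: J_iff)

lemma J_X0: "b \<in> X0.XS" and J_X1: "exp_weight b \<in> X1.XS"
  using b by (simp_all add: J_iff)

lemma J_N0_le: "N0 (b n) \<le> X0.XN b"
  using b X0.N_coord_le by (simp add: J_iff)

lemma J_N1_le: "N1 (b n) \<le> X1.XN (exp_weight b) * exp (- real_of_int n)"
proof -
  have "exp (real_of_int n) * N1 (b n) \<le> X1.XN (exp_weight b)"
    using b X1.N_coord_le[of "exp_weight b" n] B1.N_scale[OF J_mem1]
    by (simp add: J_iff exp_weight_def)
  then show ?thesis
    by (simp add: field_simps exp_minus)
qed

lemma regular_coeff: "b (int k) \<in> S1" "N1 (b (int k)) \<le> X1.XN (exp_weight b) * exp (- 1) ^ k"
  using J_mem1 J_N1_le[of "int k"] by (simp_all add: exp_of_nat_mult[symmetric])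

lemma principal_coeff: "principal_coeff b k \<in> S0" "N0 (principal_coeff b k) \<le> X0.XN b * 1 ^ k"
  using J_mem0 J_N0_le B0.zero_mem X0.seq.N_nonneg b by (auto simp: principal_coeff_def J_iff)

lemma regular_part_converges:
  "z \<in> annulus \<Longrightarrow> regular_part b z \<in> S1
    \<and> (\<lambda>n. N1 ((\<Sum>k<n. sc (z ^ k) (b (int k))) - regular_part b z)) \<longlonglongrightarrow> 0"
  unfolding regular_part_def using B1.pseries_converges[OF regular_coeff _ annulus_radius(1)] by simp

lemma principal_part_converges:
  "z \<in> annulus \<Longrightarrow> principal_part b z \<in> S0
    \<and> (\<lambda>n. N0 ((\<Sum>k<n. sc ((1 / z) ^ k) (principal_coeff b k)) - principal_part b z)) \<longlonglongrightarrow> 0"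
  unfolding principal_part_def using B0.pseries_converges[OF principal_coeff _ annulus_radius(2)] by simp

lemma regular_part_tendsto:
  assumes "s \<in> annulus"
  shows "((\<lambda>z. N1 (regular_part b z - regular_part b s)) \<longlongrightarrow> 0) (at s)"
  unfolding regular_part_def
  by (rule B1.pseries_tendsto[OF regular_coeff _ annulus_radius(1)[OF assms], where w="\<lambda>z. z"])
     (auto intro: tendsto_ident_at)

lemma principal_part_tendsto:
  assumes "s \<in> annulus"
  shows "((\<lambda>z. N0 (principal_part b z - principal_part b s)) \<longlongrightarrow> 0) (at s)"
proof -
  have "s \<noteq> 0"
    using annulusD[OF assms] by auto
  show ?thesis
    unfolding principal_part_def
    by (rule B0.pseries_tendsto[OF principal_coeff _ annulus_radius(2)[OF assms], where w="\<lambda>z. 1 / z"])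
       (use \<open>s \<noteq> 0\<close> in \<open>auto intro!: tendsto_divide tendsto_ident_at\<close>)
qed

lemma laurent_sums_parts:
  assumes z: "z \<in> annulus"
  shows "lsums b z (regular_part b z + principal_part b z)"
proof -
  let ?r = "\<lambda>n. \<Sum>k<n. sc (z ^ k) (b (int k))" and ?p = "\<lambda>n. \<Sum>k<n. sc ((1 / z) ^ k) (principal_coeff b k)"
  note R = regular_part_converges[OF z] and P = principal_part_converges[OF z]
  have mem: "?r n \<in> S1" "?p n \<in> S0" for n
    by (intro B1.sum_mem B1.scale_mem J_mem1, intro B0.sum_mem B0.scale_mem principal_coeff)
  have "(\<Sum>n\<in>{- int K..int K}. sc (z powi n) (b n)) = ?r (Suc K) + ?p (Suc K)" for K
    unfolding sum_symmetric_int_split principal_coeff_def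
    by (intro arg_cong2[where f="(+)"] sum.cong) (auto simp: power_int_minus power_one_over inverse_eq_divide)
  moreover have "(\<lambda>K. Nsum ((?r (Suc K) + ?p (Suc K)) - (regular_part b z + principal_part b z))) \<longlonglongrightarrow> 0"
  proof (rule Nsum_tendsto_add)
    show "(\<lambda>K. Nsum (?r (Suc K) - regular_part b z)) \<longlonglongrightarrow> 0"
      using R mem by (intro Nsum_tendsto_of_N1 LIMSEQ_Suc always_eventually) auto
    show "(\<lambda>K. Nsum (?p (Suc K) - principal_part b z)) \<longlonglongrightarrow> 0"
      using P mem by (intro Nsum_tendsto_of_N0 LIMSEQ_Suc always_eventually) auto
  qed (use R P mem in \<open>auto simp del: sum.lessThan_Suc intro: always_eventually sumspace_mem0 sumspace_mem1\<close>)
  ultimately show ?thesis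
    unfolding laurent_sums_def using R P
    by (simp del: sum.lessThan_Suc add: add_mem sumspace_mem0 sumspace_mem1)
qed

end

lemma laurent_val_eq:
  assumes "\<And>n. b n \<in> Ssum" "lsums b z y"
  shows "lval b z = y"
proof -
  have "y' = y" if "lsums b z y'" for y'
    using that assms unfolding laurent_sums_def
    by (intro Nsum_tendsto_unique[of "\<lambda>K. \<Sum>n\<in>{- int K..int K}. sc (z powi n) (b n)" sequentially])
       (auto intro!: always_eventually sum_mem scale_mem)
  then show ?thesis
    unfolding laurent_val_def using assms(2) by blast
qed

lemma laurent_val_parts: "b \<in> J \<Longrightarrow> z \<in> annulus \<Longrightarrow> lval b z = regular_part b z + principal_part b z"
  by (intro laurent_val_eq laurent_sums_parts J_mem)

lemma laurent_val_tendsto: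
  assumes b: "b \<in> J" and s: "s \<in> annulus"
  shows "((\<lambda>z. Nsum (lval b z - lval b s)) \<longlongrightarrow> 0) (at s)"
proof -
  have near: "\<forall>\<^sub>F z in at s. z \<in> annulus"
    by (rule eventually_at_in_open'[OF open_annulus s])
  have "((\<lambda>z. Nsum ((regular_part b z + principal_part b z)
      - (regular_part b s + principal_part b s))) \<longlongrightarrow> 0) (at s)"
    using near regular_part_converges[OF b] principal_part_converges[OF b] s
      principal_part_tendsto[OF b s] regular_part_tendsto[OF b s]
    by (intro Nsum_tendsto_add Nsum_tendsto_of_N0 Nsum_tendsto_of_N1)
       (auto elim!: eventually_mono intro: sumspace_mem0 sumspace_mem1)
  moreover have "\<forall>\<^sub>F z in at s. Nsum (lval b z - lval b s)
      = Nsum ((regular_part b z + principal_part b z) - (regular_part b s + principal_part b s))"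
    using near by eventually_elim (simp add: laurent_val_parts b s)
  ultimately show ?thesis
    using tendsto_cong by fastforce
qed

lemma laurent_term_tendsto1:
  assumes b: "b \<in> J" and z: "z \<in> annulus"
  shows "(\<lambda>K. N1 (sc (z powi (int K + 1)) (b (int K)))) \<longlonglongrightarrow> 0"
proof (rule tendsto_sandwich[OF always_eventually always_eventually tendsto_const])
  let ?A = "X1.XN (exp_weight b)"
  show "\<forall>K. 0 \<le> N1 (sc (z powi (int K + 1)) (b (int K)))"
    using b by (intro allI B1.N_nonneg B1.scale_mem J_mem1)
  show "\<forall>K. N1 (sc (z powi (int K + 1)) (b (int K))) \<le> (cmod z * ?A) * (cmod z / exp 1) ^ K"
  proof
    fix K
    have "N1 (sc (z powi (int K + 1)) (b (int K))) = cmod z ^ (K + 1) * N1 (b (int K))"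
      using B1.N_scale[OF J_mem1[OF b]] by (simp add: norm_power_int power_int_add norm_mult norm_power)
    also have "\<dots> \<le> cmod z ^ (K + 1) * (?A * exp (- real K))"
      using J_N1_le[OF b, of "int K"] by (intro mult_left_mono) auto
    also have "\<dots> = (cmod z * ?A) * (cmod z / exp 1) ^ K"
      by (simp add: exp_minus exp_of_nat_mult[symmetric] field_simps)
    finally show "N1 (sc (z powi (int K + 1)) (b (int K))) \<le> (cmod z * ?A) * (cmod z / exp 1) ^ K" .
  qed
  show "(\<lambda>K. (cmod z * ?A) * (cmod z / exp 1) ^ K) \<longlonglongrightarrow> 0"
    using annulusD[OF z] by (intro tendsto_mult_right_zero LIMSEQ_power_zero) auto
qed

lemma laurent_term_tendsto0:
  assumes b: "b \<in> J" and z: "z \<in> annulus"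
  shows "(\<lambda>K. N0 (sc (z powi (- int K)) (b (- int K - 1)))) \<longlonglongrightarrow> 0"
proof (rule tendsto_sandwich[OF always_eventually always_eventually tendsto_const])
  show "\<forall>K. 0 \<le> N0 (sc (z powi (- int K)) (b (- int K - 1)))"
    using b by (intro allI B0.N_nonneg B0.scale_mem J_mem0)
  show "\<forall>K. N0 (sc (z powi (- int K)) (b (- int K - 1))) \<le> X0.XN b * (1 / cmod z) ^ K"
  proof
    fix K
    have "N0 (sc (z powi (- int K)) (b (- int K - 1))) = (1 / cmod z) ^ K * N0 (b (- int K - 1))"
      using B0.N_scale[OF J_mem0[OF b]]
      by (simp add: norm_power_int power_int_minus power_one_over inverse_eq_divide norm_divide norm_power)
    then show "N0 (sc (z powi (- int K)) (b (- int K - 1))) \<le> X0.XN b * (1 / cmod z) ^ K"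
      using mult_left_mono[OF J_N0_le[OF b, of "- int K - 1"], of "(1 / cmod z) ^ K"]
      by (simp add: mult.commute)
  qed
  show "(\<lambda>K. X0.XN b * (1 / cmod z) ^ K) \<longlonglongrightarrow> 0"
    using annulusD[OF z] by (intro tendsto_mult_right_zero LIMSEQ_power_zero) (auto simp: divide_less_eq_1)
qed

end

locale laurent_zero = J_space sc S0 N0 S1 N1 X0 X1
  for sc :: "complex \<Rightarrow> 'v::ab_group_add \<Rightarrow> 'v" and S0 N0 S1 N1 X0 X1 +
  fixes f :: "int \<Rightarrow> 'v" and s :: complex
  assumes f_J: "f \<in> J" and s_annulus: "s \<in> annulus" and zero: "lval f s = 0"
begin

lemma s_nonzero: "s \<noteq> 0"
  using annulusD[OF s_annulus] by auto

text \<open>Two expansions of the Laurent coefficients of F(z)/(z - s), converging in B0 and in B1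
  respectively; they agree because F(s) = 0.\<close>

definition gcoeff0 :: "int \<Rightarrow> 'v" where
  "gcoeff0 n = - sc (1 / s) (B0.pseries (\<lambda>j. f (n - int j)) (1 / s))"

definition gcoeff1 :: "int \<Rightarrow> 'v" where
  "gcoeff1 n = B1.pseries (\<lambda>j. f (n + 1 + int j)) s"

lemma backward_coeff: "f (n - int j) \<in> S0" "N0 (f (n - int j)) \<le> X0.XN f * 1 ^ j"
  using J_mem0[OF f_J] J_N0_le[OF f_J] by auto

lemma forward_coeff: "f (n + 1 + int j) \<in> S1"
  "N1 (f (n + 1 + int j)) \<le> (X1.XN (exp_weight f) * exp (- real_of_int (n + 1))) * exp (- 1) ^ j"
proof -
  have "exp (- real_of_int (n + 1 + int j)) = exp (- real_of_int (n + 1)) * exp (- 1) ^ j"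
    by (simp add: exp_of_nat_mult[symmetric] exp_add[symmetric] algebra_simps)
  then show "N1 (f (n + 1 + int j)) \<le> (X1.XN (exp_weight f) * exp (- real_of_int (n + 1))) * exp (- 1) ^ j"
    using J_N1_le[OF f_J, of "n + 1 + int j"] by (simp add: mult.assoc)
qed (rule J_mem1[OF f_J])

lemma backward_pseries_converges:
  "B0.pseries (\<lambda>j. f (n - int j)) (1 / s) \<in> S0
   \<and> (\<lambda>m. N0 ((\<Sum>j<m. sc ((1 / s) ^ j) (f (n - int j))) - B0.pseries (\<lambda>j. f (n - int j)) (1 / s))) \<longlonglongrightarrow> 0"
  using B0.pseries_converges[OF backward_coeff _ annulus_radius(2)[OF s_annulus]] by simp

lemma forward_pseries_converges:
  "gcoeff1 n \<in> S1 \<and> (\<lambda>m. N1 ((\<Sum>j<m. sc (s ^ j) (f (n + 1 + int j))) - gcoeff1 n)) \<longlonglongrightarrow> 0"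
  unfolding gcoeff1_def using B1.pseries_converges[OF forward_coeff _ annulus_radius(1)[OF s_annulus]] by simp

lemma gcoeff0_mem: "gcoeff0 n \<in> S0"
  unfolding gcoeff0_def using backward_pseries_converges by (intro B0.minus_mem B0.scale_mem) blast

lemma gcoeff0_rec: "sc s (gcoeff0 n) = gcoeff0 (n - 1) - f n"
proof -
  have "B0.pseries (\<lambda>j. f (n - int j)) (1 / s)
      = f n + sc (1 / s) (B0.pseries (\<lambda>j. f (n - 1 - int j)) (1 / s))"
    using B0.pseries_unfold[OF backward_coeff[of n] _ annulus_radius(2)[OF s_annulus]]
    by (simp add: algebra_simps)
  then show ?thesis
    unfolding gcoeff0_def using s_nonzero
    by (simp add: scale_right_distrib scale_right_diff_distrib)
qed

lemma gcoeff1_rec: "gcoeff1 (n - 1) = f n + sc s (gcoeff1 n)"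
  unfolding gcoeff1_def
  using B1.pseries_unfold[OF forward_coeff[of "n - 1"] _ annulus_radius(1)[OF s_annulus]]
  by (simp add: algebra_simps)

lemma gcoeff1_eq_gcoeff0: "gcoeff1 n = gcoeff0 n"
proof -
  define D where "D n = gcoeff1 n - gcoeff0 n" for n
  have step: "sc s (D n) = D (n - 1)" for n
    using gcoeff0_rec[of n] gcoeff1_rec[of n] by (simp add: D_def scale_right_diff_distrib)
  have "regular_part f s = gcoeff1 (- 1)"
    by (simp add: regular_part_def gcoeff1_def)
  moreover have "principal_part f s = - gcoeff0 (- 1)"
    using B0.pseries_unfold[OF principal_coeff[OF f_J] _ annulus_radius(2)[OF s_annulus]]
    by (simp add: principal_part_def gcoeff0_def principal_coeff_def[abs_def] algebra_simps)
  ultimately have "D (- 1) = 0"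
    using zero laurent_val_parts[OF f_J s_annulus] by (simp add: D_def)
  then have "D 0 = 0"
    using step[of 0] s_nonzero by simp
  then have "D n = 0"
  proof (induction n rule: int_induct[where k=0])
    case (step1 i)
    then show ?case
      using step[of "i + 1"] s_nonzero by simp
  next
    case (step2 i)
    then show ?case
      using step[of i] by simp
  qed
  then show ?thesis
    by (simp add: D_def)
qed

lemma gcoeff0_mem1: "gcoeff0 n \<in> S1"
  using forward_pseries_converges gcoeff1_eq_gcoeff0 by metis

lemma gcoeff0_X0: "gcoeff0 \<in> X0.XS \<and> X0.XN gcoeff0 \<le> X0.XN f / (cmod s - 1)"
proof -
  define \<kappa> where "\<kappa> j = - ((1 / s) ^ Suc j)" for j
  have s1: "1 < cmod s"
    using annulusD[OF s_annulus] by simp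
  have "(\<lambda>j. (1 / cmod s) * (1 / cmod s) ^ j) sums ((1 / cmod s) * (1 / (1 - 1 / cmod s)))"
    using s1 by (intro sums_mult geometric_sums) (simp add: divide_less_eq_1)
  then have sums: "(\<lambda>j. cmod (\<kappa> j)) sums (1 / (cmod s - 1))"
    using s1 s_nonzero by (simp add: \<kappa>_def norm_mult norm_power norm_divide field_simps)
  have "(\<lambda>m. N0 ((\<Sum>j<m. sc (\<kappa> j) (f (n + - int j))) - gcoeff0 n)) \<longlonglongrightarrow> 0" for n
  proof -
    have "(\<Sum>j<m. sc (\<kappa> j) (f (n + - int j))) = sc (- (1 / s)) (\<Sum>j<m. sc ((1 / s) ^ j) (f (n - int j)))" for m
      by (simp add: \<kappa>_def scale_sum_right)
    moreover have "gcoeff0 n = sc (- (1 / s)) (B0.pseries (\<lambda>j. f (n - int j)) (1 / s))"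
      by (simp add: gcoeff0_def)
    ultimately show ?thesis
      using backward_pseries_converges backward_coeff
      by (simp only:) (intro B0.N_tendsto_scale B0.sum_mem B0.scale_mem, auto)
  qed
  then show ?thesis
    using X0.shift_series_mem[OF J_X0[OF f_J] sums_summable[OF sums] gcoeff0_mem, of "\<lambda>j. - int j"]
      sums_unique[OF sums]
    by (simp add: divide_inverse mult.commute)
qed

lemma gcoeff0_X1: "exp_weight gcoeff0 \<in> X1.XS \<and> X1.XN (exp_weight gcoeff0) \<le> X1.XN (exp_weight f) / (exp 1 - cmod s)"
proof -
  define E where "E = exp (1::real)"
  define \<kappa> where "\<kappa> j = s ^ j / of_real (E ^ Suc j)" for j
  have E: "0 < E" "cmod s < E"
    using annulusD[OF s_annulus] by (simp_all add: E_def)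
  have "(\<lambda>j. (1 / E) * (cmod s / E) ^ j) sums ((1 / E) * (1 / (1 - cmod s / E)))"
    using E by (intro sums_mult geometric_sums) simp
  then have sums: "(\<lambda>j. cmod (\<kappa> j)) sums (1 / (exp 1 - cmod s))"
    using E by (simp add: \<kappa>_def E_def norm_divide norm_mult norm_power power_divide field_simps)
  have conv: "(\<lambda>m. N1 ((\<Sum>j<m. sc (\<kappa> j) (exp_weight f (n + (int j + 1)))) - exp_weight gcoeff0 n))
      \<longlonglongrightarrow> 0" for n
  proof -
    let ?e = "complex_of_real (exp (real_of_int n))"
    have "\<kappa> j * complex_of_real (exp (real_of_int (n + (int j + 1)))) = ?e * s ^ j" for j
    proof -
      have "exp (real_of_int (n + (int j + 1))) = exp (real_of_int n) * E ^ Suc j"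
        by (simp add: E_def exp_add[symmetric] exp_of_nat_mult[symmetric] algebra_simps)
      then show ?thesis
        using E by (simp add: \<kappa>_def)
    qed
    then have "(\<Sum>j<m. sc (\<kappa> j) (exp_weight f (n + (int j + 1))))
        = sc ?e (\<Sum>j<m. sc (s ^ j) (f (n + 1 + int j)))" for m
      by (simp add: exp_weight_def scale_sum_right ac_simps)
    moreover have "exp_weight gcoeff0 n = sc ?e (gcoeff1 n)"
      by (simp add: exp_weight_def gcoeff1_eq_gcoeff0)
    ultimately show ?thesis
      using forward_pseries_converges forward_coeff
      by (simp only:) (intro B1.N_tendsto_scale B1.sum_mem B1.scale_mem, auto)
  qed
  have mem: "exp_weight gcoeff0 n \<in> S1" for n
    by (simp add: exp_weight_def B1.scale_mem gcoeff0_mem1)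
  show ?thesis
    using X1.shift_series_mem[OF J_X1[OF f_J] sums_summable[OF sums] mem conv] sums_unique[OF sums]
    by (simp add: divide_inverse mult.commute)
qed

lemma gcoeff0_J: "gcoeff0 \<in> J"
  using gcoeff0_mem gcoeff0_mem1 gcoeff0_X0 gcoeff0_X1 by (simp add: J_iff)

lemma Jnorm_gcoeff0_le:
  "Jnorm sc X0 X1 S0 N0 S1 N1 gcoeff0
    \<le> max (1 / (cmod s - 1)) (1 / (exp 1 - cmod s)) * Jnorm sc X0 X1 S0 N0 S1 N1 f"
proof -
  let ?\<delta> = "max (1 / (cmod s - 1)) (1 / (exp 1 - cmod s))"
  have pos: "0 < cmod s - 1" "0 < exp 1 - cmod s"
    using annulusD[OF s_annulus] by auto
  have "X0.XN gcoeff0 \<le> ?\<delta> * X0.XN f"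
    using gcoeff0_X0 X0.seq.N_nonneg[OF J_X0[OF f_J]] pos
    by (smt (verit) divide_inverse max.cobounded1 mult.commute mult_right_mono inverse_eq_divide)
  moreover have "X1.XN (exp_weight gcoeff0) \<le> ?\<delta> * X1.XN (exp_weight f)"
    using gcoeff0_X1 X1.seq.N_nonneg[OF J_X1[OF f_J]] pos
    by (smt (verit) divide_inverse max.cobounded2 mult.commute mult_right_mono inverse_eq_divide)
  moreover have "0 \<le> ?\<delta>"
    using pos by (simp add: le_max_iff_disj)
  ultimately show ?thesis
    unfolding Jnorm_eq by (smt (verit) max.cobounded1 max.cobounded2 mult_left_mono)
qed

abbreviation "F \<equiv> lval f"

lemma F_mem: "z \<in> annulus \<Longrightarrow> F z \<in> Ssum"
  using laurent_sums_parts[OF f_J] laurent_val_parts[OF f_J] by (simp add: laurent_sums_def)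

lemma quotient_partial_sum:
  assumes "z \<noteq> 0"
  defines "h \<equiv> \<lambda>n. sc (z powi (n + 1)) (gcoeff0 n)"
  shows "sc (z - s) (\<Sum>n\<in>{- int K..int K}. sc (z powi n) (gcoeff0 n))
    = (\<Sum>n\<in>{- int K..int K}. sc (z powi n) (f n)) + (h (int K) - h (- int K - 1))"
proof -
  have "sc ((z - s) * z powi n) (gcoeff0 n) = sc (z powi n) (f n) + (h n - h (n - 1))" for n
  proof -
    have "sc ((z - s) * z powi n) (gcoeff0 n) = h n - sc (z powi n) (sc s (gcoeff0 n))"
      using assms(1) by (simp add: h_def power_int_add algebra_simps scale_left_diff_distrib)
    then show ?thesis
      by (simp add: gcoeff0_rec h_def scale_right_diff_distrib)
  qed
  then show ?thesis
    by (simp add: scale_sum_right sum.distrib sum_symmetric_int_telescope[of h])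
qed

lemma laurent_sums_quotient:
  assumes z: "z \<in> annulus" and zs: "z \<noteq> s"
  shows "lsums gcoeff0 z (sc (1 / (z - s)) (F z))"
proof -
  define h where "h n = sc (z powi (n + 1)) (gcoeff0 n)" for n
  let ?Sf = "\<lambda>K. \<Sum>n\<in>{- int K..int K}. sc (z powi n) (f n)"
  have z0: "z \<noteq> 0"
    using annulusD[OF z] by auto
  have h_mem: "h n \<in> S0" "h n \<in> S1" for n
    by (simp_all add: h_def B0.scale_mem B1.scale_mem gcoeff0_mem gcoeff0_mem1)
  have Sf_mem: "?Sf K \<in> Ssum" for K
    using J_mem[OF f_J] by (intro sum_mem scale_mem)
  have "(\<lambda>K. Nsum (?Sf K - F z)) \<longlonglongrightarrow> 0"
    using laurent_sums_parts[OF f_J z] laurent_val_parts[OF f_J z] by (simp add: laurent_sums_def)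
  moreover have "(\<lambda>K. Nsum (h (int K) - 0)) \<longlonglongrightarrow> 0"
    using laurent_term_tendsto1[OF gcoeff0_J z] h_mem B1.zero_mem
    by (intro Nsum_tendsto_of_N1 always_eventually) (auto simp: h_def)
  moreover have "(\<lambda>K. Nsum (- h (- int K - 1) - 0)) \<longlonglongrightarrow> 0"
    using laurent_term_tendsto0[OF gcoeff0_J z] h_mem B0.zero_mem
    by (intro Nsum_tendsto_of_N0 always_eventually)
       (auto simp: h_def B0.N_minus B0.scale_mem gcoeff0_mem intro: B0.minus_mem)
  ultimately have "(\<lambda>K. Nsum (((?Sf K + h (int K)) + - h (- int K - 1)) - ((F z + 0) + 0))) \<longlonglongrightarrow> 0"
    using Sf_mem F_mem[OF z] h_mem sumspace_mem0[OF B0.zero_mem]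
    by (intro Nsum_tendsto_add always_eventually) (auto intro: add_mem sumspace_mem0 sumspace_mem1 B0.minus_mem)
  moreover have "(?Sf K + h (int K)) + - h (- int K - 1) \<in> Ssum" for K
    using Sf_mem h_mem by (meson add_mem sumspace_mem0 sumspace_mem1 B0.minus_mem)
  ultimately have "(\<lambda>K. Nsum (sc (1 / (z - s)) ((?Sf K + h (int K)) + - h (- int K - 1))
      - sc (1 / (z - s)) (F z))) \<longlonglongrightarrow> 0"
    using F_mem[OF z] by (intro Nsum_tendsto_scale always_eventually allI) simp_all
  moreover have "sc (1 / (z - s)) ((?Sf K + h (int K)) + - h (- int K - 1))
      = (\<Sum>n\<in>{- int K..int K}. sc (z powi n) (gcoeff0 n))" for K
  proof -
    have "(?Sf K + h (int K)) + - h (- int K - 1) = sc (z - s) (\<Sum>n\<in>{- int K..int K}. sc (z powi n) (gcoeff0 n))"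
      using quotient_partial_sum[OF z0, of K] by (simp add: h_def)
    then show ?thesis
      using zs by simp
  qed
  ultimately show ?thesis
    unfolding laurent_sums_def using F_mem[OF z] by (simp add: scale_mem)
qed

abbreviation "G \<equiv> lval gcoeff0"

lemma G_mem: "z \<in> annulus \<Longrightarrow> G z \<in> Ssum"
  using laurent_sums_parts[OF gcoeff0_J] laurent_val_parts[OF gcoeff0_J] by (simp add: laurent_sums_def)

lemma laurent_sums_G: "z \<in> annulus \<Longrightarrow> lsums gcoeff0 z (G z)"
  using laurent_sums_parts[OF gcoeff0_J] laurent_val_parts[OF gcoeff0_J] by simp

lemma difference_quotient_eq_G:
  "\<forall>\<^sub>F z in at s. sc (1 / (z - s)) (F z - F s) = G z"
  using eventually_at_in_open[OF open_annulus s_annulus]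
  by eventually_elim (simp add: zero laurent_val_eq[OF J_mem[OF gcoeff0_J] laurent_sums_quotient])

lemma has_deriv_sum_F: "has_deriv_sum sc S0 N0 S1 N1 F s (G s)"
  unfolding has_deriv_sum_def
proof
  show "G s \<in> Ssum"
    by (rule G_mem[OF s_annulus])
  have "\<forall>\<^sub>F z in at s. Nsum (G z - G s) = Nsum (sc (1 / (z - s)) (F z - F s) - G s)"
    using difference_quotient_eq_G by eventually_elim simp
  with laurent_val_tendsto[OF gcoeff0_J s_annulus]
  show "((\<lambda>z. Nsum (sc (1 / (z - s)) (F z - F s) - G s)) \<longlongrightarrow> 0) (at s)"
    by (rule tendsto_cong[THEN iffD1, rotated])
qed

lemma the_deriv_F: "(THE D. has_deriv_sum sc S0 N0 S1 N1 F s D) = G s"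
proof (intro the_equality has_deriv_sum_F)
  have "\<forall>\<^sub>F z in at s. F z \<in> Ssum"
    using eventually_at_in_open'[OF open_annulus s_annulus] by (rule eventually_mono) (rule F_mem)
  then show "D = G s" if "has_deriv_sum sc S0 N0 S1 N1 F s D" for D
    by (rule has_deriv_sum_unique[OF _ F_mem[OF s_annulus] that has_deriv_sum_F])
qed

end

theorem lemma3p3:
  fixes sc :: "complex \<Rightarrow> 'v::ab_group_add \<Rightarrow> 'v"
    and S0 S1 :: "'v set" and N0 N1 :: "'v \<Rightarrow> real"
    and X0 X1 :: "'v pseudolat"
    and f :: "int \<Rightarrow> 'v" and s :: complex
  assumes "vector_space sc"
    and "banach_couple sc S0 N0 S1 N1"
    and "pseudolattice sc X0" and "pseudolattice sc X1"
    and "translation_invariant sc X0" and "translation_invariant sc X1"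
    and "f \<in> Jset sc X0 X1 S0 N0 S1 N1"
    and "s \<in> annulus"
    and "laurent_val sc S0 N0 S1 N1 f s = 0"
  shows "let F = laurent_val sc S0 N0 S1 N1 f;
             g = (\<lambda>z. if z = s then (THE D. has_deriv_sum sc S0 N0 S1 N1 F s D)
                      else sc (1 / (z - s)) (F z));
             \<delta> = max (1 / (cmod s - 1)) (1 / (exp 1 - cmod s))
         in in_F sc X0 X1 S0 N0 S1 N1 g
            \<and> (\<exists>gc\<in>Jset sc X0 X1 S0 N0 S1 N1.
                 (\<forall>z\<in>annulus. laurent_sums sc S0 N0 S1 N1 gc z (g z))
                 \<and> Jnorm sc X0 X1 S0 N0 S1 N1 gc \<le> \<delta> * Jnorm sc X0 X1 S0 N0 S1 N1 f)"
proof -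
  interpret laurent_zero sc S0 N0 S1 N1 X0 X1 f s
    by (intro laurent_zero.intro J_space.intro banach_couple_space.intro banach_couple_space_axioms.intro
        J_space_axioms.intro laurent_zero_axioms.intro assms)
  have "\<forall>z\<in>annulus. lsums gcoeff0 z
      (if z = s then (THE D. has_deriv_sum sc S0 N0 S1 N1 F s D) else sc (1 / (z - s)) (F z))"
    using laurent_sums_G[OF s_annulus] laurent_sums_quotient by (simp add: the_deriv_F)
  then show ?thesis
    unfolding Let_def in_F_def using gcoeff0_J Jnorm_gcoeff0_le by blast
qed

end
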